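(* Let $n \in \{5,6\}$, and let $G$ be a non-cyclic quotient of the braid group $B_n$. Then $G \cong S_n$ or $|G| > n!$.
   Context: $B_n$ is the braid group on $n$ strands, with standard generators $\sigma_1,\dots,\sigma_{n-1}$ and relations $\sigma_i\sigma_j=\sigma_j\sigma_i$ for $|i-j|\ge 2$ and $\sigma_i\sigma_{i+1}\sigma_i=\sigma_{i+1}\sigma_i\sigma_{i+1}$. Its abelianization $B_n/B_n'$ is infinite cyclic. A homomorphism $B_n\to G$ is called cyclic if it factors through the abelianization $B_n \to B_n/B_n'\cong\mathbb{Z}$, and non-cyclic otherwise. A non-cyclic quotient of $B_n$ is a group $G$ for which there is a surjective non-cyclic homomorphism $B_n\to G$. $S_n$ is the symmetric group on $n$ letters. If $G$ is infinite, the inequality $|G|>n!$ is understood to hold. *)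

theory Defs
  imports "HOL-Algebra.Algebra"
begin

section \<open>Groups given by generators and relations\<close>

text \<open>
  The letter \<open>(g, True)\<close> stands for the generator \<open>g\<close> and \<open>(g, False)\<close> for its formal inverse.
  A relation \<open>u = v\<close> is encoded as the pair \<open>(u, v)\<close>.
\<close>

type_synonym 'g word = "('g \<times> bool) list"

definition words :: "'g set \<Rightarrow> 'g word set"
  where "words S = lists (S \<times> UNIV)"

inductive_set word_cong :: "'g set \<Rightarrow> ('g word \<times> 'g word) set \<Rightarrow> ('g word \<times> 'g word) set"
  for S :: "'g set" and R :: "('g word \<times> 'g word) set"
  where
    relation: "(u, v) \<in> R \<Longrightarrow> u \<in> words S \<Longrightarrow> v \<in> words S \<Longrightarrow> (u, v) \<in> word_cong S R"
  | cancel: "g \<in> S \<Longrightarrow> ([(g, b), (g, \<not> b)], []) \<in> word_cong S R"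
  | refl: "w \<in> words S \<Longrightarrow> (w, w) \<in> word_cong S R"
  | sym: "(u, v) \<in> word_cong S R \<Longrightarrow> (v, u) \<in> word_cong S R"
  | trans: "(u, v) \<in> word_cong S R \<Longrightarrow> (v, w) \<in> word_cong S R \<Longrightarrow> (u, w) \<in> word_cong S R"
  | append: "(u, u') \<in> word_cong S R \<Longrightarrow> (v, v') \<in> word_cong S R
      \<Longrightarrow> (u @ v, u' @ v') \<in> word_cong S R"

definition presented_group :: "'g set \<Rightarrow> ('g word \<times> 'g word) set \<Rightarrow> 'g word set monoid"
  where "presented_group S R =
    \<lparr> carrier = words S // word_cong S R,
      monoid.mult = (\<lambda>A B. \<Union>u\<in>A. \<Union>v\<in>B. word_cong S R `` {u @ v}),
      one = word_cong S R `` {[]} \<rparr>"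

lemma word_cong_words:
  "(u, v) \<in> word_cong S R \<Longrightarrow> u \<in> words S \<and> v \<in> words S"
  by (induction rule: word_cong.induct) (auto simp: words_def)

lemma equiv_word_cong: "equiv (words S) (word_cong S R)"
proof (rule equivI)
  show "word_cong S R \<subseteq> words S \<times> words S"
    using word_cong_words by fast
  show "refl_on (words S) (word_cong S R)"
    by (auto intro: refl_onI word_cong.refl)
  show "Relation.sym (word_cong S R)"
    by (rule symI) (rule word_cong.sym)
  show "Relation.trans (word_cong S R)"
    by (rule transI) (rule word_cong.trans)
qed

lemma presented_group_mult:
  assumes "u \<in> words S" "v \<in> words S"
  shows "word_cong S R `` {u} \<otimes>\<^bsub>presented_group S R\<^esub> word_cong S R `` {v}
    = word_cong S R `` {u @ v}"
proof -
  have "congruent2 (word_cong S R) (word_cong S R) (\<lambda>u v. word_cong S R `` {u @ v})"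
  proof (rule congruent2I')
    fix u u' v v'
    assume "(u, u') \<in> word_cong S R" "(v, v') \<in> word_cong S R"
    then have "(u @ v, u' @ v') \<in> word_cong S R"
      by (rule word_cong.append)
    then show "word_cong S R `` {u @ v} = word_cong S R `` {u' @ v'}"
      by (rule equiv_class_eq[OF equiv_word_cong])
  qed
  from UN_equiv_class2[OF equiv_word_cong equiv_word_cong this assms] show ?thesis
    by (simp add: presented_group_def)
qed

lemma presented_group_inverse:
  assumes "w \<in> words S"
  shows "(map (\<lambda>(g, b). (g, \<not> b)) (rev w) @ w, []) \<in> word_cong S R"
  using assms
proof (induction w)
  case Nil
  then show ?case by (simp add: word_cong.refl)
next
  case (Cons a w)
  obtain g b where a: "a = (g, b)" by fastforce
  define w' where "w' = map (\<lambda>(g, b). (g, \<not> b)) (rev w)"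
  have g: "g \<in> S" and w: "w \<in> words S"
    using Cons.prems a by (auto simp: words_def)
  have w': "w' \<in> words S"
    using w by (auto simp: words_def w'_def)
  have "([(g, \<not> b), (g, b)], []) \<in> word_cong S R"
    using word_cong.cancel[OF g, of "\<not> b"] by simp
  then have "([(g, \<not> b), (g, b)] @ w, [] @ w) \<in> word_cong S R"
    using word_cong.append word_cong.refl[OF w] by blast
  then have "(w' @ ([(g, \<not> b), (g, b)] @ w), w' @ ([] @ w)) \<in> word_cong S R"
    using word_cong.append word_cong.refl[OF w'] by blast
  moreover have "(w' @ w, []) \<in> word_cong S R"
    using Cons.IH[OF w] by (simp add: w'_def)
  ultimately show ?case
    using word_cong.trans[of "w' @ [(g, \<not> b), (g, b)] @ w" "w' @ w"] by (simp add: a w'_def)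
qed

lemma group_presented_group: "group (presented_group S R)"
proof (rule groupI)
  have app: "u @ v \<in> words S" if "u \<in> words S" "v \<in> words S" for u v :: "'a word"
    using that by (simp add: words_def)
  have nil: "[] \<in> words S" by (simp add: words_def)
  have carr: "carrier (presented_group S R) = (\<lambda>w. word_cong S R `` {w}) ` words S"
    by (auto simp: presented_group_def quotient_def)
  have one: "\<one>\<^bsub>presented_group S R\<^esub> = word_cong S R `` {[]}"
    by (simp add: presented_group_def)
  show "x \<otimes>\<^bsub>presented_group S R\<^esub> y \<in> carrier (presented_group S R)"
    if "x \<in> carrier (presented_group S R)" "y \<in> carrier (presented_group S R)" for x y
    using that by (auto simp: carr presented_group_mult app)
  show "\<one>\<^bsub>presented_group S R\<^esub> \<in> carrier (presented_group S R)"
    using nil by (auto simp: carr one)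
  show "x \<otimes>\<^bsub>presented_group S R\<^esub> y \<otimes>\<^bsub>presented_group S R\<^esub> z
      = x \<otimes>\<^bsub>presented_group S R\<^esub> (y \<otimes>\<^bsub>presented_group S R\<^esub> z)"
    if "x \<in> carrier (presented_group S R)" "y \<in> carrier (presented_group S R)"
      "z \<in> carrier (presented_group S R)" for x y z
    using that by (auto simp: carr presented_group_mult app)
  show "\<one>\<^bsub>presented_group S R\<^esub> \<otimes>\<^bsub>presented_group S R\<^esub> x = x"
    if "x \<in> carrier (presented_group S R)" for x
    using that nil by (auto simp: carr one presented_group_mult)
  show "\<exists>y\<in>carrier (presented_group S R). y \<otimes>\<^bsub>presented_group S R\<^esub> x = \<one>\<^bsub>presented_group S R\<^esub>"
    if x: "x \<in> carrier (presented_group S R)" for x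
  proof -
    obtain w where w: "w \<in> words S" "x = word_cong S R `` {w}"
      using x by (auto simp: carr)
    define w' where "w' = map (\<lambda>(g, b). (g, \<not> b)) (rev w)"
    have w': "w' \<in> words S"
      using w by (auto simp: words_def w'_def)
    have "word_cong S R `` {w' @ w} = word_cong S R `` {[]}"
      using presented_group_inverse[OF w(1), of R] equiv_class_eq[OF equiv_word_cong]
      unfolding w'_def by blast
    then show ?thesis
      using w w' by (auto simp: carr one presented_group_mult)
  qed
qed


section \<open>The braid group and its non-cyclic quotients\<close>

abbreviation (input) \<sigma> :: "nat \<Rightarrow> nat \<times> bool"
  where "\<sigma> i \<equiv> (i, True)"

definition braid_relations :: "nat \<Rightarrow> (nat word \<times> nat word) set"
  where "braid_relations n =
    {([\<sigma> i, \<sigma> j], [\<sigma> j, \<sigma> i]) | i j.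
       i \<in> {1..<n} \<and> j \<in> {1..<n} \<and> \<bar>int i - int j\<bar> \<ge> 2} \<union>
    {([\<sigma> i, \<sigma> (i + 1), \<sigma> i], [\<sigma> (i + 1), \<sigma> i, \<sigma> (i + 1)]) | i.
       i \<in> {1..<n} \<and> i + 1 \<in> {1..<n}}"

definition braid_group :: "nat \<Rightarrow> nat word set monoid"
  where "braid_group n = presented_group {1..<n} (braid_relations n)"

lemma group_braid_group: "group (braid_group n)"
  by (simp add: braid_group_def group_presented_group)

text \<open>
  \<open>f\<close> is cyclic if it factors through the canonical projection onto the abelianization
  \<open>B Mod derived B (carrier B)\<close>.
\<close>

definition cyclic_hom ::
  "('a, 'c) monoid_scheme \<Rightarrow> ('b, 'd) monoid_scheme \<Rightarrow> ('a \<Rightarrow> 'b) \<Rightarrow> bool"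
  where "cyclic_hom B G f \<longleftrightarrow>
    (\<exists>h \<in> hom (B Mod derived B (carrier B)) G.
       \<forall>x \<in> carrier B. f x = h (derived B (carrier B) #>\<^bsub>B\<^esub> x))"

definition noncyclic_braid_quotient :: "nat \<Rightarrow> ('a, 'b) monoid_scheme \<Rightarrow> bool"
  where "noncyclic_braid_quotient n G \<longleftrightarrow>
    group G \<and> (\<exists>f \<in> epi (braid_group n) G. \<not> cyclic_hom (braid_group n) G f)"

end

theory Submission
  imports Defs
begin

text \<open>
  Let \<open>s\<^sub>1, \<dots>, s\<^sub>n\<^sub>-\<^sub>1\<close> be the images in \<open>G\<close> of the standard generators. If two neighbours commute, the
  braid relation makes them equal, the equality spreads along the chain of generators, and \<open>G\<close> is
  abelian (\<open>gens_all_equal\<close>, \<open>commutative_if_collapsed\<close>). So in a non-cyclic quotient no two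
  neighbouring generators commute, and this alone forces \<open>G\<close> to be large.

  The order is bounded below by a chain of centralizers
  \[ G \supseteq C(s_1) \supseteq C(s_1, s_3) \supseteq C(s_1, s_3, s_4). \]
  At each step the index is at least the number of known conjugates, under the bigger group, of the
  element being added (\<open>card_conj_orbit_le\<close>).
  \<^item> The element \<open>s\<^sub>1\<close> has the \<open>n (n - 1) / 2\<close> band generators among its conjugates, one for each pair
    of strands. For \<open>n \<ge> 5\<close> they stay distinct in \<open>G\<close>, because no two of them commute with exactly the
    same standard generators (\<open>commute_band_iff\<close>, \<open>band_linked_inject\<close>).
  \<^item> The group \<open>C(s\<^sub>1)\<close> contains \<open>s\<^sub>3, \<dots>, s\<^sub>n\<^sub>-\<^sub>1\<close>; these give 3 conjugates of \<open>s\<^sub>3\<close> if \<open>n = 5\<close> and 6 if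
    \<open>n = 6\<close>.
  \<^item> The group \<open>C(s\<^sub>1, s\<^sub>3)\<close> contains \<open>s\<^sub>3\<close>, and \<open>s\<^sub>5\<close> if \<open>n = 6\<close>; these give 2 conjugates of \<open>s\<^sub>4\<close> if
    \<open>n = 5\<close>, and if \<open>n = 6\<close> they give 3, or 4 when the generators are involutions.
  \<^item> The last centralizer contains the powers of \<open>s\<^sub>1\<close>.

  If \<open>s\<^sub>1\<close> is not an involution, there are at least 3 powers, and the order is at least
  \<open>10 * 3 * 2 * 3 = 180 > 5!\<close> or \<open>15 * 6 * 3 * 3 = 810 > 6!\<close>. If it is an involution, the bounds become
  \<open>10 * 3 * 2 * 2 = 5!\<close> and \<open>15 * 6 * 4 * 2 = 6!\<close>, and the \<open>s\<^sub>i\<close> satisfy the Coxeter relations of the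
  symmetric group.

  In the latter case \<open>G\<close> is identified with \<open>S\<^sub>n\<close> by a graph argument (\<open>iso_sym_group_if_large\<close>). The
  pairs consisting of \<open>s\<^sub>i\<close> and the \<open>i\<close>-th adjacent transposition generate a subgroup \<open>R\<close> of
  \<open>G \<times> S\<^sub>n\<close>. They too satisfy the Coxeter relations, so \<open>R\<close> has at most \<open>n!\<close> elements by counting
  normal forms (\<open>generate_card_le_fact\<close>). But \<open>R\<close> projects onto \<open>G\<close> and onto \<open>S\<^sub>n\<close>, both of order at
  least \<open>n!\<close>, so both projections are isomorphisms.
\<close>

section \<open>Conjugation, commuting pairs and braided pairs\<close>

context group
begin

definition conj_by :: "'a \<Rightarrow> 'a \<Rightarrow> 'a"
  where "conj_by g x = g \<otimes> x \<otimes> inv g"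

definition commute :: "'a \<Rightarrow> 'a \<Rightarrow> bool"
  where "commute x y \<longleftrightarrow> x \<otimes> y = y \<otimes> x"

definition braided :: "'a \<Rightarrow> 'a \<Rightarrow> bool"
  where "braided x y \<longleftrightarrow> x \<otimes> y \<otimes> x = y \<otimes> x \<otimes> y"

lemma inv_mult_cancel:
  assumes "g \<in> carrier G" "x \<in> carrier G"
  shows "inv g \<otimes> (g \<otimes> x) = x" "g \<otimes> (inv g \<otimes> x) = x"
  using assms by (simp_all flip: m_assoc)

lemma conj_by_closed [simp, intro]:
  "\<lbrakk>g \<in> carrier G; x \<in> carrier G\<rbrakk> \<Longrightarrow> conj_by g x \<in> carrier G"
  by (simp add: conj_by_def)

lemma conj_by_one [simp]: "x \<in> carrier G \<Longrightarrow> conj_by \<one> x = x"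
  by (simp add: conj_by_def)

lemma conj_by_mult_left:
  "\<lbrakk>g \<in> carrier G; h \<in> carrier G; x \<in> carrier G\<rbrakk>
    \<Longrightarrow> conj_by (g \<otimes> h) x = conj_by g (conj_by h x)"
  by (simp add: conj_by_def m_assoc inv_mult_group)

lemma conj_by_mult_right:
  "\<lbrakk>g \<in> carrier G; x \<in> carrier G; y \<in> carrier G\<rbrakk>
    \<Longrightarrow> conj_by g (x \<otimes> y) = conj_by g x \<otimes> conj_by g y"
  by (simp add: conj_by_def m_assoc inv_mult_cancel)

lemma conj_by_inv_cancel [simp]:
  assumes "g \<in> carrier G" "x \<in> carrier G"
  shows "conj_by g (conj_by (inv g) x) = x" "conj_by (inv g) (conj_by g x) = x"
  using assms by (simp_all flip: conj_by_mult_left)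

lemma conj_by_inject [simp]:
  "\<lbrakk>g \<in> carrier G; x \<in> carrier G; y \<in> carrier G\<rbrakk>
    \<Longrightarrow> conj_by g x = conj_by g y \<longleftrightarrow> x = y"
  by (metis conj_by_inv_cancel(2))

lemma conj_by_eq_self_iff:
  "\<lbrakk>g \<in> carrier G; x \<in> carrier G\<rbrakk> \<Longrightarrow> conj_by g x = x \<longleftrightarrow> commute g x"
  unfolding conj_by_def commute_def by (metis inv_solve_right m_closed)

lemma commute_refl [simp]: "commute x x"
  by (simp add: commute_def)

lemma commute_sym: "commute x y \<longleftrightarrow> commute y x"
  by (auto simp: commute_def)

lemma commute_conj_iff:
  assumes "g \<in> carrier G" "x \<in> carrier G" "y \<in> carrier G"
  shows "commute (conj_by g x) (conj_by g y) \<longleftrightarrow> commute x y"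
  using assms unfolding commute_def by (simp flip: conj_by_mult_right)

lemma commute_conj_right:
  assumes "g \<in> carrier G" "x \<in> carrier G" "y \<in> carrier G" "commute x g"
  shows "commute x (conj_by g y) \<longleftrightarrow> commute x y"
  using assms by (metis commute_conj_iff commute_sym conj_by_eq_self_iff)

lemma braided_sym: "braided x y \<longleftrightarrow> braided y x"
  by (auto simp: braided_def)

lemma braided_conj:
  assumes "a \<in> carrier G" "b \<in> carrier G" "braided a b"
  shows "conj_by (a \<otimes> b) a = b"
proof -
  have "a \<otimes> b \<otimes> a = b \<otimes> (a \<otimes> b)"
    using assms by (simp add: braided_def m_assoc)
  then show ?thesis
    unfolding conj_by_def using assms by (metis inv_solve_right m_closed)
qed

text \<open>
  In terms of arcs in the punctured disc: pushing \<open>b\<close> over \<open>a\<close> one way gives the same arc as pushing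
  \<open>a\<close> over \<open>b\<close> the other way. Most distinctness arguments below come from moving a conjugation across
  a braided pair with this rule.
\<close>

lemma braided_conj_inv:
  assumes "a \<in> carrier G" "b \<in> carrier G" "braided a b"
  shows "conj_by a b = conj_by (inv b) a"
proof -
  have "conj_by b (conj_by a b) = a"
    using braided_conj[of b a] assms by (simp add: braided_sym conj_by_mult_left)
  then show ?thesis
    using assms by (metis conj_by_closed conj_by_inv_cancel(2))
qed

lemma braided_commute_imp_eq:
  assumes "a \<in> carrier G" "b \<in> carrier G" "braided a b" "commute a b"
  shows "a = b"
  using assms by (metis braided_conj_inv commute_sym conj_by_eq_self_iff conj_by_inv_cancel(2))

text \<open>
  Conjugating by \<open>b\<close> turns the question about \<open>a\<close> into one about \<open>b\<inverse> a b = a b a\<inverse>\<close>, and conjugating back by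
  \<open>a\<close>, which fixes \<open>x\<close>, leaves \<open>b\<close>.
\<close>

lemma commute_conj_braided:
  assumes "a \<in> carrier G" "b \<in> carrier G" "x \<in> carrier G" "braided a b" "commute a x"
  shows "commute a (conj_by b x) \<longleftrightarrow> commute b x"
proof -
  have "commute a (conj_by b x) \<longleftrightarrow> commute (conj_by (inv b) a) x"
    using assms commute_conj_iff[of "inv b" a "conj_by b x"] by simp
  also have "conj_by (inv b) a = conj_by a b"
    using assms by (simp add: braided_conj_inv)
  also have "commute (conj_by a b) x \<longleftrightarrow> commute (conj_by a b) (conj_by a x)"
    using assms by (simp add: conj_by_eq_self_iff[THEN iffD2])
  also have "\<dots> \<longleftrightarrow> commute b x"
    using assms by (simp add: commute_conj_iff)
  finally show ?thesis .
qed

text \<open>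
  Conjugation by \<open>b a\<close> carries the commuting pair \<open>b\<close>, \<open>x\<close> to the pair in the conclusion.
\<close>

lemma commute_conj_conj_braided:
  assumes "a \<in> carrier G" "b \<in> carrier G" "x \<in> carrier G" "braided a b" "commute b x"
  shows "commute a (conj_by b (conj_by a x))"
proof -
  have "conj_by (b \<otimes> a) b = a"
    using assms by (simp add: braided_conj braided_sym)
  then show ?thesis
    using assms commute_conj_iff[of "b \<otimes> a" b x] by (simp add: conj_by_mult_left)
qed

section \<open>Centralizers and an orbit count\<close>

text \<open>
  The orbit of \<open>x\<close> is taken under the centralizer of \<open>A\<close>, so its size is the index of the centralizer
  of \<open>insert x A\<close> in that of \<open>A\<close>. A lower bound for this index needs some elements of the orbit only,
  and \<open>conj_orbit_conj\<close> and \<open>conj_orbit_braided\<close> supply them.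
\<close>

definition centralizer :: "'a set \<Rightarrow> 'a set"
  where "centralizer A = {g \<in> carrier G. \<forall>a\<in>A. commute g a}"

definition conj_orbit :: "'a set \<Rightarrow> 'a \<Rightarrow> 'a set"
  where "conj_orbit A x = (\<lambda>g. conj_by g x) ` centralizer A"

lemma centralizer_carrier: "g \<in> centralizer A \<Longrightarrow> g \<in> carrier G"
  by (simp add: centralizer_def)

lemma subgroup_centralizer:
  assumes "A \<subseteq> carrier G"
  shows "subgroup (centralizer A) G"
proof (rule subgroupI)
  show "centralizer A \<subseteq> carrier G" "centralizer A \<noteq> {}"
    using assms by (auto simp: centralizer_def commute_def intro!: exI[of _ \<one>])
next
  fix g assume g: "g \<in> centralizer A"
  have "commute (inv g) a" if "a \<in> A" for a
  proof -
    have "a \<in> carrier G" "commute g a" "g \<in> carrier G"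
      using g that assms by (auto simp: centralizer_def)
    then show ?thesis
      by (metis conj_by_eq_self_iff conj_by_inv_cancel(2) inv_closed)
  qed
  then show "inv g \<in> centralizer A"
    using g by (simp add: centralizer_def)
next
  fix g h assume gh: "g \<in> centralizer A" "h \<in> centralizer A"
  have "commute (g \<otimes> h) a" if "a \<in> A" for a
  proof -
    have "a \<in> carrier G" "commute g a" "g \<in> carrier G" "commute h a" "h \<in> carrier G"
      using gh that assms by (auto simp: centralizer_def)
    then show ?thesis
      by (metis conj_by_eq_self_iff conj_by_mult_left m_closed)
  qed
  then show "g \<otimes> h \<in> centralizer A"
    using gh by (simp add: centralizer_def)
qed

lemma centralizer_mult:
  "\<lbrakk>A \<subseteq> carrier G; g \<in> centralizer A; h \<in> centralizer A\<rbrakk> \<Longrightarrow> g \<otimes> h \<in> centralizer A"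
  by (rule subgroup.m_closed[OF subgroup_centralizer])

lemma conj_orbit_base:
  assumes "A \<subseteq> carrier G" "x \<in> carrier G"
  shows "x \<in> conj_orbit A x"
  unfolding conj_orbit_def
  using assms subgroup.one_closed[OF subgroup_centralizer] by (auto intro!: image_eqI[of _ _ \<one>])

lemma conj_orbit_conj:
  assumes "A \<subseteq> carrier G" "x \<in> carrier G" "y \<in> conj_orbit A x" "h \<in> centralizer A"
  shows "conj_by h y \<in> conj_orbit A x"
proof -
  obtain g where g: "g \<in> centralizer A" "y = conj_by g x"
    using assms by (auto simp: conj_orbit_def)
  then have "conj_by h y = conj_by (h \<otimes> g) x"
    using assms by (simp add: conj_by_mult_left centralizer_carrier)
  then show ?thesis
    using g assms centralizer_mult by (auto simp: conj_orbit_def)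
qed

lemma conj_orbit_braided:
  assumes "A \<subseteq> carrier G" "x \<in> carrier G" "a \<in> conj_orbit A x"
    and "a \<in> centralizer A" "b \<in> centralizer A" "braided a b"
  shows "b \<in> conj_orbit A x"
  using conj_orbit_conj[of A x a "a \<otimes> b"] braided_conj[of a b] assms
  by (simp add: centralizer_mult centralizer_carrier)

text \<open>
  The lower half of the orbit-stabilizer theorem: choosing a conjugating element for each \<open>y \<in> T\<close>
  gives representatives of distinct left cosets of the smaller centralizer.
\<close>

lemma card_conj_orbit_le:
  assumes fin: "finite (carrier G)" and A: "A \<subseteq> carrier G" and x: "x \<in> carrier G"
    and T: "T \<subseteq> conj_orbit A x"
  shows "card T * card (centralizer (insert x A)) \<le> card (centralizer A)"
proof -
  obtain r where r: "\<And>y. y \<in> T \<Longrightarrow> r y \<in> centralizer A \<and> conj_by (r y) x = y"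
    using T unfolding conj_orbit_def by (metis (no_types, lifting) image_iff subset_eq)
  have eq: "conj_by (r y \<otimes> k) x = y" if "y \<in> T" "k \<in> centralizer (insert x A)" for y k
  proof -
    have "k \<in> carrier G" "conj_by k x = x" "r y \<in> carrier G"
      using that x r by (auto simp: centralizer_def conj_by_eq_self_iff)
    then show ?thesis
      using r that x by (simp add: conj_by_mult_left)
  qed
  have sub: "centralizer (insert x A) \<subseteq> centralizer A"
    by (auto simp: centralizer_def)
  have "inj_on (\<lambda>(y, k). r y \<otimes> k) (T \<times> centralizer (insert x A))"
  proof (rule inj_onI, clarify)
    fix y k y' k'
    assume *: "y \<in> T" "k \<in> centralizer (insert x A)" "y' \<in> T" "k' \<in> centralizer (insert x A)"
      "r y \<otimes> k = r y' \<otimes> k'"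
    then have "y = y'"
      using eq by metis
    moreover have "k \<in> carrier G" "k' \<in> carrier G" "r y \<in> carrier G"
      using * r centralizer_carrier by blast+
    ultimately show "y = y' \<and> k = k'"
      using * by simp
  qed
  moreover have "(\<lambda>(y, k). r y \<otimes> k) ` (T \<times> centralizer (insert x A)) \<subseteq> centralizer A"
    using r sub A by (auto intro!: centralizer_mult)
  moreover have "finite (centralizer A)"
    using fin by (simp add: centralizer_def)
  ultimately have "card (T \<times> centralizer (insert x A)) \<le> card (centralizer A)"
    by (rule card_inj_on_le)
  then show ?thesis
    by (simp add: card_cartesian_product)
qed

lemma order_ge_of_conj_orbits:
  assumes fin: "finite (carrier G)" and xyz: "x \<in> carrier G" "y \<in> carrier G" "z \<in> carrier G"
    and T: "T \<subseteq> conj_orbit {} x" and U: "U \<subseteq> conj_orbit {x} y" and V: "V \<subseteq> conj_orbit {x, y} z"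
    and K: "K \<subseteq> centralizer {x, y, z}"
  shows "card T * (card U * (card V * card K)) \<le> order G"
proof -
  have "card V * card K \<le> card V * card (centralizer {z, x, y})"
    using K fin by (intro mult_left_mono card_mono) (auto simp: centralizer_def)
  also have "\<dots> \<le> card (centralizer {y, x})"
    using card_conj_orbit_le[of "{x, y}" z V] xyz fin V by (simp add: insert_commute)
  finally have "card U * (card V * card K) \<le> card U * card (centralizer {y, x})"
    by (rule mult_left_mono) simp
  also have "\<dots> \<le> card (centralizer {x})"
    using card_conj_orbit_le[of "{x}" y U] xyz fin U by simp
  finally have "card T * (card U * (card V * card K)) \<le> card T * card (centralizer {x})"
    by (rule mult_left_mono) simp
  also have "\<dots> \<le> card (centralizer {})"
    using card_conj_orbit_le[of "{}" x T] xyz fin T by simp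
  finally show ?thesis
    by (simp add: centralizer_def order_def)
qed

lemma card_braid3_conjugates:
  assumes [simp]: "a \<in> carrier G" "b \<in> carrier G"
    and ab: "\<not> commute a b"
  shows "card {a, b, conj_by b a} = 3" "card {b, conj_by a b} = 2"
proof -
  have "a \<noteq> b" "conj_by b a \<noteq> a" "conj_by b a \<noteq> b" "conj_by a b \<noteq> b"
    using ab conj_by_eq_self_iff[of b a] conj_by_eq_self_iff[of a b] conj_by_eq_self_iff[of b b]
      conj_by_inject[of b a b]
    by (auto simp: commute_sym)
  then show "card {a, b, conj_by b a} = 3" "card {b, conj_by a b} = 2"
    by auto
qed

text \<open>
  The model is the symmetric group on four letters with \<open>a, b, c\<close> the adjacent transpositions, where
  the six elements are all the transpositions. Within each of the pairs \<open>a, c\<close> and \<open>b, l\<close> and \<open>p, q\<close> of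
  the proof (disjoint transpositions in the model), the same elements among \<open>a, b, c\<close> commute with
  both members; elements of different pairs are told apart by this property. Members of one pair
  are separated by \<open>a \<noteq> c\<close>. This hypothesis is essential, since \<open>S\<^sub>4\<close> has the quotient \<open>S\<^sub>3\<close> in which
  \<open>a = c\<close>.
\<close>

lemma card_braid4_conjugates:
  assumes carr [simp]: "a \<in> carrier G" "b \<in> carrier G" "c \<in> carrier G"
    and br: "braided a b" "braided b c" and ac: "commute a c" "a \<noteq> c"
    and ab: "\<not> commute a b" and bc: "\<not> commute b c"
  shows "card {a, b, c, conj_by b a, conj_by b c, conj_by c (conj_by b a)} = 6"
    and "card {b, conj_by a b, conj_by c b} = 3"
    and "b \<otimes> b = \<one> \<Longrightarrow> card {b, conj_by a b, conj_by c b, conj_by a (conj_by c b)} = 4"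
proof -
  (* p, q, l play the roles of (1 3), (2 4), (1 4) when a, b, c are (1 2), (2 3), (3 4) *)
  define p where "p = conj_by b a"
  define q where "q = conj_by b c"
  define l where "l = conj_by c p"
  have cl [simp]: "p \<in> carrier G" "q \<in> carrier G" "l \<in> carrier G"
    by (auto simp: p_def q_def l_def)
  have br': "braided c b" "braided b a"
    using br braided_sym by auto
  have ca: "commute c a" using ac commute_sym by blast
  have p: "\<not> commute a p" "\<not> commute b p" "\<not> commute c p"
    using ab ca br br' commute_conj_braided[of a b a] commute_conj_right[of b b a]
      commute_conj_braided[of c b a] unfolding p_def by (auto simp: commute_sym)
  have q: "\<not> commute a q" "\<not> commute b q" "\<not> commute c q"
    using bc ac br br' commute_conj_braided[of a b c] commute_conj_right[of b b c]
      commute_conj_braided[of c b c] unfolding q_def by (auto simp: commute_sym)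
  have l: "commute b l" "\<not> commute c l" "\<not> commute a l"
    using commute_conj_conj_braided[of b c a] commute_conj_right[of c c p]
      commute_conj_right[of c a p] br ca ac p unfolding l_def p_def by auto
  have "b \<noteq> l"
  proof
    assume "b = l"
    then have "conj_by (inv c) b = p"
      unfolding l_def using conj_by_inv_cancel(2)[of c p] by simp
    moreover have "conj_by (inv c) b = q"
      unfolding q_def using braided_conj_inv[of b c] br by simp
    ultimately show False
      using ac unfolding p_def q_def by simp
  qed
  moreover have "p \<noteq> q"
    using ac unfolding p_def q_def by simp
  moreover have "distinct [a, b, c, p] \<and> q \<notin> {a, b, c} \<and> l \<notin> {a, c, p, q}"
    using ab bc ac p q l by (auto simp: commute_sym)
  ultimately have "card {a, b, c, p, q, l} = 6"
    by auto
  then show "card {a, b, c, conj_by b a, conj_by b c, conj_by c (conj_by b a)} = 6"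
    by (simp add: p_def q_def l_def)
  have ne: "conj_by a b \<noteq> b" "conj_by c b \<noteq> b"
    using ab bc by (auto simp: conj_by_eq_self_iff commute_sym)
  have ne2: "conj_by a b \<noteq> conj_by c b"
    using br br' ac braided_conj_inv[of a b] braided_conj_inv[of c b] by simp
  show "card {b, conj_by a b, conj_by c b} = 3"
    using ne ne2 by auto
  assume bb: "b \<otimes> b = \<one>"
  have ib: "inv b = b"
    using bb by (simp add: inv_equality)
  have swap: "conj_by a (conj_by c b) = conj_by c (conj_by a b)"
    using ac by (simp add: commute_def flip: conj_by_mult_left)
  have "conj_by a (conj_by c b) \<noteq> b"
  proof
    assume "conj_by a (conj_by c b) = b"
    then have "conj_by c b = conj_by (inv a) b"
      using conj_by_inv_cancel(2)[of a "conj_by c b"] by simp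
    also have "\<dots> = conj_by b a"
      using braided_conj_inv[of b a] br' by simp
    finally have "conj_by b c = conj_by b a"
      using braided_conj_inv[of c b] br' ib by simp
    then show False using ac by simp
  qed
  moreover have "conj_by a (conj_by c b) \<noteq> conj_by a b"
    using ne by simp
  moreover have "conj_by a (conj_by c b) \<noteq> conj_by c b"
    unfolding swap using ne by simp
  ultimately show "card {b, conj_by a b, conj_by c b, conj_by a (conj_by c b)} = 4"
    using ne ne2 by auto
qed

end

section \<open>Tuples satisfying the braid relations\<close>

locale braid_tuple = group G for G (structure) +
  fixes s :: "nat \<Rightarrow> 'a" and n :: nat
  assumes gen_closed [simp]: "\<lbrakk>1 \<le> i; i < n\<rbrakk> \<Longrightarrow> s i \<in> carrier G"
    and far_commute: "\<lbrakk>1 \<le> i; i + 2 \<le> j; j < n\<rbrakk> \<Longrightarrow> commute (s i) (s j)"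
    and next_braided: "\<lbrakk>1 \<le> i; i + 1 < n\<rbrakk> \<Longrightarrow> braided (s i) (s (i + 1))"
begin

lemma gens_commute:
  assumes "1 \<le> i" "i < n" "1 \<le> j" "j < n" "j \<noteq> i + 1" "i \<noteq> j + 1"
  shows "commute (s i) (s j)"
proof -
  consider "i + 2 \<le> j" | "j + 2 \<le> i" | "i = j"
    using assms by linarith
  then show ?thesis
    by cases (use far_commute assms commute_sym in auto)
qed

text \<open>
  Neighbouring generators are conjugate by the braid relation, hence all generators are.
\<close>

lemma gens_in_conj_orbit:
  assumes "1 \<le> i" "i < n"
  shows "s i \<in> conj_orbit {} (s 1)"
  using assms
proof (induction i rule: dec_induct)
  case base
  then show ?case by (simp add: conj_orbit_base)
next
  case (step i)
  then show ?case
    using conj_orbit_braided[of "{}" "s 1" "s i" "s (Suc i)"] next_braided[of i]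
    by (simp add: centralizer_def)
qed

lemma involutions:
  assumes "s 1 \<otimes> s 1 = \<one>" "1 \<le> i" "i < n"
  shows "s i \<otimes> s i = \<one>"
proof -
  obtain g where g: "g \<in> carrier G" "s i = conj_by g (s 1)"
    using gens_in_conj_orbit assms by (auto simp: conj_orbit_def centralizer_def)
  then have "s i \<otimes> s i = conj_by g (s 1 \<otimes> s 1)"
    using assms(2,3) by (simp add: conj_by_mult_right)
  then show ?thesis
    using assms g by (simp add: conj_by_def)
qed

text \<open>
  If \<open>s\<^sub>j = s\<^sub>j\<^sub>+\<^sub>1\<close>, then \<open>s\<^sub>j\<^sub>+\<^sub>2\<close> commutes with \<open>s\<^sub>j = s\<^sub>j\<^sub>+\<^sub>1\<close>, and being braided with it is equal to it; the same
  happens downwards.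
\<close>

lemma gens_all_equal:
  assumes k: "1 \<le> k" "k + 1 < n" "commute (s k) (s (k + 1))" and i: "1 \<le> i" "i < n"
  shows "s i = s 1"
proof -
  have eq: "s (j + 1) = s j" if "1 \<le> j" "j + 1 < n" "commute (s j) (s (j + 1))" for j
    using braided_commute_imp_eq[of "s j" "s (j + 1)"] next_braided[of j] that by simp
  have link: "commute (s j) (s (j + 1)) \<longleftrightarrow> commute (s (j + 1)) (s (j + 2))"
    if "1 \<le> j" "j + 2 < n" for j
    using eq[of j] eq[of "j + 1"] far_commute[of j "j + 2"] that by auto
  have first: "commute (s 1) (s (1 + 1))"
    using k
  proof (induction k rule: dec_induct)
    case (step j)
    then show ?case using link[of j] by simp
  qed simp
  have all: "commute (s j) (s (j + 1))" if "1 \<le> j" "j + 1 < n" for j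
    using that first
  proof (induction j rule: dec_induct)
    case (step j)
    then show ?case using link[of j] by simp
  qed simp
  show ?thesis
    using i
  proof (induction i rule: dec_induct)
    case (step j)
    then show ?case using eq[of j] all[of j] by simp
  qed simp
qed

text \<open>
  This is the band generator that exchanges strands \<open>i\<close> and \<open>i + d + 1\<close>. The number \<open>d\<close> of strands
  passed over is the recursion variable, so the first strand stays fixed while the band is stretched.
\<close>

primrec band :: "nat \<Rightarrow> nat \<Rightarrow> 'a"
  where
    "band i 0 = s i"
  | "band i (Suc d) = conj_by (s (i + d + 1)) (band i d)"

text \<open>
  The indices of the standard generators whose arc shares exactly one end point with the arc of
  \<open>band i d\<close>; by \<open>commute_band_iff\<close> below these are the generators that do not commute with it.
  Indices \<open>0\<close> and \<open>n\<close>, which belong to no generator, may occur at the ends.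
\<close>

definition band_linked :: "nat \<Rightarrow> nat \<Rightarrow> nat set"
  where "band_linked i d = (if d = 0 then {i - 1, i + 1} else {i - 1, i, i + d, i + d + 1})"

lemma band_closed [simp]: "\<lbrakk>1 \<le> i; i + d < n\<rbrakk> \<Longrightarrow> band i d \<in> carrier G"
  by (induction d) auto

lemma band_in_conj_orbit:
  "\<lbrakk>1 \<le> i; i + d < n\<rbrakk> \<Longrightarrow> band i d \<in> conj_orbit {} (s 1)"
  by (induction d) (auto intro!: conj_orbit_conj gens_in_conj_orbit simp: centralizer_def simp del: One_nat_def)

text \<open>
  The least linked index is \<open>i - 1\<close>, which is visible unless \<open>i = 1\<close>; hence different first strands
  leave only the case that one of them is strand 1, and there the indices up to 4 suffice to tell the
  bands apart. With four strands the claim is false: strands 1, 2 and strands 3, 4 give bands that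
  are both linked to the generator 2 only.
\<close>

lemma band_linked_inject:
  assumes n: "5 \<le> n" and ij: "1 \<le> i" "i + d < n" "1 \<le> j" "j + e < n"
    and eq: "\<And>k. \<lbrakk>1 \<le> k; k < n\<rbrakk> \<Longrightarrow> k \<in> band_linked i d \<longleftrightarrow> k \<in> band_linked j e"
  shows "i = j \<and> d = e"
proof -
  have le: "j \<le> i"
    if ij: "1 \<le> i" "i + d < n" "1 \<le> j" "j + e < n"
      and eq: "\<And>k. \<lbrakk>1 \<le> k; k < n\<rbrakk> \<Longrightarrow> k \<in> band_linked i d \<longleftrightarrow> k \<in> band_linked j e"
    for i d j e
  proof (rule ccontr)
    assume ji: "\<not> j \<le> i"
    then have "i - 1 \<in> band_linked i d" "i - 1 \<notin> band_linked j e"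
      using ij by (auto simp: band_linked_def)
    with eq[of "i - 1"] have "\<not> (1 \<le> i - 1 \<and> i - 1 < n)"
      by blast
    with ij have i: "i = 1" by linarith
    (* membership without truncated subtraction, in linear arithmetic *)
    have L: "k \<in> band_linked i d \<longleftrightarrow> (d = 0 \<and> k = 2 \<or> d \<noteq> 0 \<and> (k = 1 \<or> k = d + 1 \<or> k = d + 2))"
      if "1 \<le> k" for k
      using that by (auto simp: band_linked_def i)
    have R: "k \<in> band_linked j e \<longleftrightarrow>
      (k + 1 = j \<or> k = j + e + 1 \<or> e \<noteq> 0 \<and> (k = j \<or> k = j + e))" for k
      using ji i by (auto simp: band_linked_def)
    have small: "(d = 0 \<and> k = 2 \<or> d \<noteq> 0 \<and> (k = 1 \<or> k = d + 1 \<or> k = d + 2)) \<longleftrightarrow>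
      (k + 1 = j \<or> k = j + e + 1 \<or> e \<noteq> 0 \<and> (k = j \<or> k = j + e))"
      if "1 \<le> k" "k \<le> 4" for k
      using eq[of k] L[of k] R[of k] n that by simp
    have "n > j + e" "j > 1" using ij ji i by auto
    then show False
      using small[of 1, simplified] small[of 2, simplified] small[of 3, simplified]
        small[of 4, simplified] n
      by presburger
  qed
  have ji: "i = j"
    by (rule antisym; rule le) (use ij eq in auto)
  have "i \<in> band_linked i d \<longleftrightarrow> i \<in> band_linked i e"
    "i + d \<in> band_linked i d \<longleftrightarrow> i + d \<in> band_linked i e"
    "i + e \<in> band_linked i d \<longleftrightarrow> i + e \<in> band_linked i e"
    using eq[of i] eq[of "i + d"] eq[of "i + e"] ij unfolding ji by simp_all
  then have "d = e"
    using ij(1) by (cases "d = 0"; cases "e = 0") (auto simp: band_linked_def)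
  with ji show ?thesis by simp
qed

end

locale noncollapsed_braid_tuple = braid_tuple +
  assumes next_not_commute: "\<lbrakk>1 \<le> i; i + 1 < n\<rbrakk> \<Longrightarrow> \<not> commute (s i) (s (i + 1))"
begin

text \<open>
  Stretching the band by one strand conjugates it by \<open>s\<^sub>m\<close> with \<open>m = i + d\<close>. Generators that commute with
  \<open>s\<^sub>m\<close> keep their relation to the band. The generator \<open>s\<^sub>m\<^sub>+\<^sub>1\<close> becomes linked because \<open>s\<^sub>m\<close> was, and
  \<open>s\<^sub>m\<^sub>-\<^sub>1\<close> is freed if the band already passed a strand: its arc then lies between the two feet. This
  last case looks back two steps, hence the strong induction.
\<close>

lemma commute_band_iff:
  assumes "1 \<le> i" "i + d < n" "1 \<le> k" "k < n"
  shows "commute (s k) (band i d) \<longleftrightarrow> k \<notin> band_linked i d"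
  using assms
proof (induction d arbitrary: k rule: less_induct)
  case (less d)
  show ?case
  proof (cases d)
    case 0
    have "\<not> commute (s k) (s i)" if "k = i - 1 \<or> k = i + 1"
      using that next_not_commute[of k] next_not_commute[of i] less.prems
      by (auto simp: commute_sym)
    then show ?thesis
      using 0 less.prems gens_commute[of k i] by (auto simp: band_linked_def)
  next
    case (Suc e)
    define m where "m = i + e + 1"
    define t where "t = band i e"
    have m: "m < n" "1 \<le> m" and t [simp]: "t \<in> carrier G"
      using less.prems Suc by (auto simp: m_def t_def)
    have band: "band i d = conj_by (s m) t"
      by (simp add: Suc m_def t_def)
    have IH: "commute (s k) t \<longleftrightarrow> k \<notin> band_linked i e" if "1 \<le> k" "k < n" for k
      unfolding t_def using less.IH[of e k] that less.prems Suc by simp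
    have linked: "m \<in> band_linked i e" "m \<in> band_linked i d"
      "m + 1 \<in> band_linked i d" "i \<in> band_linked i d"
      by (simp_all add: band_linked_def m_def Suc)
    consider "k = m" | "k = m + 1" | "k + 1 = m" | "k \<noteq> m" "k \<noteq> m + 1" "k + 1 \<noteq> m"
      by blast
    then show ?thesis
    proof cases
      case 1
      then show ?thesis
        using commute_conj_right[of "s m" "s m" t] IH[of m] m linked by (simp add: band)
    next
      case 2
      then have "commute (s k) t" "\<not> commute (s m) t"
        using IH[of k] IH[of m] m less.prems by (auto simp: band_linked_def m_def)
      then show ?thesis
        using 2 commute_conj_braided[of "s k" "s m" t] next_braided[of m] m less.prems linked
        by (auto simp: band braided_sym)
    next
      case 3
      show ?thesis
      proof (cases e)
        case 0
        then have "k = i" "m = i + 1" "t = s i"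
          using 3 by (auto simp: m_def t_def)
        then show ?thesis
          using commute_conj_braided[of "s i" "s m" "s i"] next_braided[of i]
            next_not_commute[of i] m less.prems linked
          by (auto simp: band commute_sym)
      next
        case (Suc e')
        have "commute (s m) (band i e')"
          using less.IH[of e' m] less.prems m \<open>d = Suc e\<close> Suc
          by (auto simp: band_linked_def m_def)
        moreover have "t = conj_by (s k) (band i e')"
          using 3 Suc by (simp add: t_def m_def)
        ultimately have "commute (s k) (band i d)"
          unfolding band
          using commute_conj_conj_braided[of "s k" "s m" "band i e'"] 3 m less.prems
            next_braided[of k] \<open>d = Suc e\<close> Suc
          by simp
        then show ?thesis
          using 3 \<open>d = Suc e\<close> Suc less.prems by (simp add: band_linked_def m_def)
      qed
    next
      case 4
      then have "commute (s k) (s m)"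
        using gens_commute[of k m] less.prems m by auto
      moreover have "k \<in> band_linked i d \<longleftrightarrow> k \<in> band_linked i e"
        using 4 by (auto simp: band_linked_def m_def Suc)
      ultimately show ?thesis
        unfolding band
        using commute_conj_right[of "s m" "s k" t] IH[of k] m less.prems by simp
    qed
  qed
qed


text \<open>
  The index set runs through the pairs of distinct strands \<open>i < i + d + 1 \<le> n\<close>.
\<close>

definition bands :: "'a set"
  where "bands = (\<lambda>(i, d). band i d) ` (SIGMA i:{1..<n}. {..<n - i})"

lemma card_bands:
  assumes "5 \<le> n"
  shows "card bands = (\<Sum>i = 1..<n. n - i)"
proof -
  have "inj_on (\<lambda>(i, d). band i d) (SIGMA i:{1..<n}. {..<n - i})"
  proof (rule inj_onI, clarify)
    fix i d j e
    assume *: "i \<in> {1..<n}" "d < n - i" "j \<in> {1..<n}" "e < n - j" "band i d = band j e"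
    have "k \<in> band_linked i d \<longleftrightarrow> k \<in> band_linked j e" if "1 \<le> k" "k < n" for k
      using commute_band_iff[of i d k] commute_band_iff[of j e k] * that by auto
    then show "i = j \<and> d = e"
      using * assms by (intro band_linked_inject) auto
  qed
  then show ?thesis
    by (simp add: bands_def card_image)
qed

lemma bands_subset: "bands \<subseteq> conj_orbit {} (s 1)"
  by (auto simp: bands_def simp del: One_nat_def intro!: band_in_conj_orbit)

text \<open>
  The generator \<open>s\<^sub>2\<close> commutes with \<open>s\<^sub>5\<close> but not with \<open>s\<^sub>3\<close>.
\<close>

lemma gens_3_5_distinct:
  assumes "n = 6"
  shows "s 3 \<noteq> s 5"
  using far_commute[of 2 5] next_not_commute[of 2] assms by auto

text \<open>
  The constant is \<open>10 * 3 * 2\<close>: ten bands, three conjugates of \<open>s\<^sub>3\<close> under \<open>C(s\<^sub>1)\<close> and two conjugates of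
  \<open>s\<^sub>4\<close> under \<open>C(s\<^sub>1, s\<^sub>3)\<close>.
\<close>

lemma order_ge_five:
  assumes n: "n = 5" and fin: "finite (carrier G)" and K: "K \<subseteq> centralizer {s 1, s 3, s 4}"
  shows "60 * card K \<le> order G"
proof -
  have br: "braided (s 3) (s 4)" and nc: "\<not> commute (s 3) (s 4)"
    using next_braided[of 3] next_not_commute[of 3] n by simp_all
  have c1: "s 3 \<in> centralizer {s 1}" "s 4 \<in> centralizer {s 1}" and c13: "s 3 \<in> centralizer {s 1, s 3}"
    using far_commute[of 1 3] far_commute[of 1 4] n by (simp_all add: centralizer_def commute_sym)
  have 1: "s 3 \<in> conj_orbit {s 1} (s 3)"
    using n by (intro conj_orbit_base) auto
  moreover from 1 have "s 4 \<in> conj_orbit {s 1} (s 3)"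
    using conj_orbit_braided[OF _ _ 1 c1 br] n by simp
  ultimately have U: "{s 3, s 4, conj_by (s 4) (s 3)} \<subseteq> conj_orbit {s 1} (s 3)"
    using conj_orbit_conj[OF _ _ _ c1(2)] n by simp
  have "s 4 \<in> conj_orbit {s 1, s 3} (s 4)"
    using n by (intro conj_orbit_base) auto
  then have V: "{s 4, conj_by (s 3) (s 4)} \<subseteq> conj_orbit {s 1, s 3} (s 4)"
    using conj_orbit_conj[OF _ _ _ c13] n by simp
  have "{1..<5} = {1, 2, 3, 4 :: nat}" by auto
  then have b: "card bands = 10"
    using card_bands n by simp
  moreover have carr: "s 1 \<in> carrier G" "s 3 \<in> carrier G" "s 4 \<in> carrier G"
    using n by simp_all
  ultimately show ?thesis
    using order_ge_of_conj_orbits[OF fin carr bands_subset U V K]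
    unfolding b card_braid3_conjugates[OF carr(2,3) nc] by simp
qed

text \<open>
  The constants are \<open>15 * 6 * 3\<close> and \<open>15 * 6 * 4\<close>. The fourth conjugate of \<open>s\<^sub>4\<close> under \<open>C(s\<^sub>1, s\<^sub>3)\<close>, by the
  product \<open>s\<^sub>3 s\<^sub>5\<close>, is shown to be different from the others only when \<open>s\<^sub>4\<close> is an involution; this is
  exactly the case in which the weaker constant would not reach \<open>6!\<close>.
\<close>

lemma order_ge_six:
  assumes n: "n = 6" and fin: "finite (carrier G)" and K: "K \<subseteq> centralizer {s 1, s 3, s 4}"
  shows "270 * card K \<le> order G" and "s 4 \<otimes> s 4 = \<one> \<Longrightarrow> 360 * card K \<le> order G"
proof -
  have br: "braided (s 3) (s 4)" "braided (s 4) (s 5)"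
    and nc: "\<not> commute (s 3) (s 4)" "\<not> commute (s 4) (s 5)"
    and c: "commute (s 3) (s 5)"
    using next_braided[of 3] next_not_commute[of 3] next_braided[of 4] next_not_commute[of 4]
      far_commute[of 3 5] n by simp_all
  have c1: "s 3 \<in> centralizer {s 1}" "s 4 \<in> centralizer {s 1}" "s 5 \<in> centralizer {s 1}"
    and c13: "s 3 \<in> centralizer {s 1, s 3}" "s 5 \<in> centralizer {s 1, s 3}"
    using far_commute[of 1 3] far_commute[of 1 4] far_commute[of 1 5] c n
    by (simp_all add: centralizer_def commute_sym)
  let ?U = "{s 3, s 4, s 5, conj_by (s 4) (s 3), conj_by (s 4) (s 5), conj_by (s 5) (conj_by (s 4) (s 3))}"
  let ?V = "{s 4, conj_by (s 3) (s 4), conj_by (s 5) (s 4)}"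
  let ?V' = "{s 4, conj_by (s 3) (s 4), conj_by (s 5) (s 4), conj_by (s 3) (conj_by (s 5) (s 4))}"
  have 3: "s 3 \<in> conj_orbit {s 1} (s 3)"
    using n by (intro conj_orbit_base) auto
  then have 4: "s 4 \<in> conj_orbit {s 1} (s 3)"
    using conj_orbit_braided[OF _ _ 3 c1(1,2) br(1)] n by simp
  then have 5: "s 5 \<in> conj_orbit {s 1} (s 3)"
    using conj_orbit_braided[OF _ _ 4 c1(2,3) br(2)] n by simp
  have U: "?U \<subseteq> conj_orbit {s 1} (s 3)"
    using 3 4 5 conj_orbit_conj[OF _ _ _ c1(2)] conj_orbit_conj[OF _ _ _ c1(3)] n by simp
  have "s 4 \<in> conj_orbit {s 1, s 3} (s 4)"
    using n by (intro conj_orbit_base) auto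
  then have V': "?V' \<subseteq> conj_orbit {s 1, s 3} (s 4)"
    using conj_orbit_conj[OF _ _ _ c13(1)] conj_orbit_conj[OF _ _ _ c13(2)] n by simp
  then have V: "?V \<subseteq> conj_orbit {s 1, s 3} (s 4)"
    by simp
  have "{1..<6} = {1, 2, 3, 4, 5 :: nat}" by auto
  then have b: "card bands = 15"
    using card_bands n by simp
  have carr: "s 1 \<in> carrier G" "s 3 \<in> carrier G" "s 4 \<in> carrier G" "s 5 \<in> carrier G"
    using n by simp_all
  note cards = card_braid4_conjugates[OF carr(2-4) br c gens_3_5_distinct[OF n] nc]
  show "270 * card K \<le> order G"
    using order_ge_of_conj_orbits[OF fin carr(1-3) bands_subset U V K]
    unfolding b cards by simp
  show "360 * card K \<le> order G" if "s 4 \<otimes> s 4 = \<one>"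
    using order_ge_of_conj_orbits[OF fin carr(1-3) bands_subset U V' K]
    unfolding b cards(1) cards(3)[OF that] by simp
qed

lemma first_gen_powers:
  assumes "5 \<le> n"
  shows "{\<one>, s 1} \<subseteq> centralizer {s 1, s 3, s 4}" "card {\<one>, s 1} = 2"
    and "{\<one>, s 1, s 1 \<otimes> s 1} \<subseteq> centralizer {s 1, s 3, s 4}"
    and "s 1 \<otimes> s 1 \<noteq> \<one> \<Longrightarrow> card {\<one>, s 1, s 1 \<otimes> s 1} = 3"
proof -
  have carr: "{s 1, s 3, s 4} \<subseteq> carrier G"
    using assms by simp
  have "\<one> \<in> centralizer {s 1, s 3, s 4}"
    using subgroup.one_closed[OF subgroup_centralizer[OF carr]] .
  moreover have s1: "s 1 \<in> centralizer {s 1, s 3, s 4}"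
    using far_commute[of 1 3] far_commute[of 1 4] assms by (simp add: centralizer_def)
  ultimately show "{\<one>, s 1} \<subseteq> centralizer {s 1, s 3, s 4}"
    and "{\<one>, s 1, s 1 \<otimes> s 1} \<subseteq> centralizer {s 1, s 3, s 4}"
    using centralizer_mult[OF carr s1 s1] by blast+
  have ne: "\<one> \<noteq> s 1"
  proof
    assume "\<one> = s 1"
    moreover have "s 2 \<in> carrier G"
      using assms by simp
    ultimately have "commute (s 1) (s 2)"
      unfolding commute_def by (metis l_one r_one)
    then show False
      using next_not_commute[of 1] assms by (simp add: numeral_2_eq_2)
  qed
  then show "card {\<one>, s 1} = 2" by simp
  have "s 1 \<otimes> s 1 \<noteq> s 1"
    using ne gen_closed[of 1] assms by auto
  then show "card {\<one>, s 1, s 1 \<otimes> s 1} = 3" if "s 1 \<otimes> s 1 \<noteq> \<one>"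
    using ne that by auto
qed

lemma order_gt_fact_if_not_involution:
  assumes n: "n \<in> {5, 6}" and fin: "finite (carrier G)" and ninv: "s 1 \<otimes> s 1 \<noteq> \<one>"
  shows "fact n < order G"
proof -
  have n5: "5 \<le> n" using n by auto
  note K = first_gen_powers(3)[OF n5] and card3 = first_gen_powers(4)[OF n5 ninv]
  from n consider "n = 5" | "n = 6" by blast
  then show ?thesis
  proof cases
    case 1
    show ?thesis
      using order_ge_five[OF 1 fin K] unfolding card3 by (simp add: 1 fact_numeral)
  next
    case 2
    show ?thesis
      using order_ge_six(1)[OF 2 fin K] unfolding card3 by (simp add: 2 fact_numeral)
  qed
qed

lemma order_ge_fact_if_involution:
  assumes n: "n \<in> {5, 6}" and fin: "finite (carrier G)" and inv: "s 1 \<otimes> s 1 = \<one>"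
  shows "fact n \<le> order G"
proof -
  have n5: "5 \<le> n" using n by auto
  note K = first_gen_powers(1)[OF n5] and card2 = first_gen_powers(2)[OF n5]
  from n consider "n = 5" | "n = 6" by blast
  then show ?thesis
  proof cases
    case 1
    show ?thesis
      using order_ge_five[OF 1 fin K] unfolding card2 by (simp add: 1 fact_numeral)
  next
    case 2
    then have "s 4 \<otimes> s 4 = \<one>"
      using involutions[OF inv] by simp
    then show ?thesis
      using order_ge_six(2)[OF 2 fin K] unfolding card2 by (simp add: 2 fact_numeral)
  qed
qed

end

section \<open>Tuples satisfying the Coxeter relations\<close>

locale coxeter_tuple = braid_tuple +
  assumes involution: "\<lbrakk>1 \<le> i; i < n\<rbrakk> \<Longrightarrow> s i \<otimes> s i = \<one>"
begin

text \<open>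
  The descending product \<open>s\<^sub>j\<^sub>+\<^sub>d\<^sub>-\<^sub>1 \<cdots> s\<^sub>j\<close> of \<open>d\<close> generators. In the symmetric group, the \<open>k\<close> products that
  start at \<open>s\<^sub>k\<close> and the empty product represent the cosets of \<open>S\<^sub>k\<close> in \<open>S\<^sub>k\<^sub>+\<^sub>1\<close>.
\<close>

primrec descend :: "nat \<Rightarrow> nat \<Rightarrow> 'a"
  where
    "descend j 0 = \<one>"
  | "descend j (Suc d) = s (j + d) \<otimes> descend j d"

lemma descend_closed [simp]: "\<lbrakk>1 \<le> j; j + d \<le> n\<rbrakk> \<Longrightarrow> descend j d \<in> carrier G"
  by (induction d) auto

lemma descend_append:
  "\<lbrakk>1 \<le> j; j + d < n\<rbrakk> \<Longrightarrow> descend (Suc j) d \<otimes> s j = descend j (Suc d)"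
  by (induction d) (auto simp: m_assoc)

lemma descend_cancel:
  assumes "1 \<le> j" "j + d < n"
  shows "descend j (Suc d) \<otimes> s j = descend (Suc j) d"
  using assms by (simp add: descend_append[symmetric] m_assoc involution del: descend.simps)

lemma descend_far:
  assumes "1 \<le> j" "j + d \<le> n" "1 \<le> i" "i < n" "i + 2 \<le> j \<or> j + d < i"
  shows "descend j d \<otimes> s i = s i \<otimes> descend j d"
  using assms
proof (induction d)
  case (Suc d)
  have "s (j + d) \<otimes> s i = s i \<otimes> s (j + d)"
    using gens_commute[of "j + d" i] Suc.prems by (auto simp: commute_def)
  moreover have [simp]: "s (j + d) \<in> carrier G" "s i \<in> carrier G" "descend j d \<in> carrier G"
    using Suc.prems by auto
  ultimately have "s (j + d) \<otimes> (s i \<otimes> descend j d) = s i \<otimes> (s (j + d) \<otimes> descend j d)"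
    by (simp flip: m_assoc)
  moreover have "descend j d \<otimes> s i = s i \<otimes> descend j d"
    using Suc by auto
  ultimately show ?case
    by (simp add: m_assoc)
qed simp

text \<open>
  A generator strictly inside the range of a descending product passes through it and comes out
  with its index lowered by one, by a single braid relation.
\<close>

lemma descend_shift:
  assumes "1 \<le> j" "j + d \<le> n" "j < i" "i < j + d"
  shows "descend j d \<otimes> s i = s (i - 1) \<otimes> descend j d"
  using assms
proof (induction d)
  case (Suc d)
  show ?case
  proof (cases "i = j + d")
    case False
    then have IH: "descend j d \<otimes> s i = s (i - 1) \<otimes> descend j d"
      using Suc by simp
    have "s (j + d) \<otimes> s (i - 1) = s (i - 1) \<otimes> s (j + d)"
      using gens_commute[of "j + d" "i - 1"] Suc.prems False by (auto simp: commute_def)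
    then have "s (j + d) \<otimes> (s (i - 1) \<otimes> descend j d) = s (i - 1) \<otimes> (s (j + d) \<otimes> descend j d)"
      using Suc.prems by (simp flip: m_assoc)
    then show ?thesis
      using Suc.prems IH by (simp add: m_assoc)
  next
    case True
    then obtain e where d: "d = Suc e" and i: "i = j + e + 1"
      using Suc.prems by (cases d) auto
    define D where "D = descend j e"
    have D [simp]: "D \<in> carrier G" and far: "D \<otimes> s i = s i \<otimes> D"
      using descend_far[of j e i] Suc.prems i by (auto simp: D_def)
    have carr [simp]: "s i \<in> carrier G" "s (j + e) \<in> carrier G"
      using Suc.prems i by auto
    have br: "s i \<otimes> s (j + e) \<otimes> s i = s (j + e) \<otimes> s i \<otimes> s (j + e)"
      using next_braided[of "j + e"] Suc.prems i by (simp add: braided_def)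
    have "descend j (Suc d) \<otimes> s i = s i \<otimes> s (j + e) \<otimes> (D \<otimes> s i)"
      by (simp add: d i D_def[symmetric] m_assoc del: carr) (use carr i in \<open>simp add: m_assoc\<close>)
    also have "\<dots> = s (j + e) \<otimes> s i \<otimes> s (j + e) \<otimes> D"
      unfolding far by (simp add: br flip: m_assoc)
    also have "\<dots> = s (i - 1) \<otimes> descend j (Suc d)"
      using carr by (simp add: d i D_def[symmetric] m_assoc)
    finally show ?thesis .
  qed
qed simp

text \<open>
  Normal forms for the Coxeter group generated by \<open>s\<^sub>1, \<dots>, s\<^sub>k\<^sub>-\<^sub>1\<close>: a normal form of the group on one
  strand less, times a coset representative. Different pairs may give the same element, and only the
  upper bound \<open>k!\<close> is claimed.
\<close>

primrec normal_forms :: "nat \<Rightarrow> 'a set"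
  where
    "normal_forms 0 = {\<one>}"
  | "normal_forms (Suc k) =
      (\<lambda>(w, j). w \<otimes> descend j (Suc k - j)) ` (normal_forms k \<times> {1..Suc k})"

lemma normal_forms_closed: "\<lbrakk>k \<le> n; w \<in> normal_forms k\<rbrakk> \<Longrightarrow> w \<in> carrier G"
  by (induction k arbitrary: w) auto

lemma one_in_normal_forms: "k \<le> n \<Longrightarrow> \<one> \<in> normal_forms k"
proof (induction k)
  case (Suc k)
  then show ?case by (auto intro!: image_eqI[of _ _ "(\<one>, Suc k)"])
qed simp

lemma card_normal_forms: "finite (normal_forms k) \<and> card (normal_forms k) \<le> fact k"
proof (induction k)
  case (Suc k)
  then have "card (normal_forms (Suc k)) \<le> card (normal_forms k \<times> {1..Suc k})"
    unfolding normal_forms.simps by (intro card_image_le) simp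
  also have "\<dots> \<le> fact k * Suc k"
    using Suc by (simp only: card_cartesian_product) (intro mult_mono, auto)
  finally show ?case using Suc by (simp add: algebra_simps)
qed simp

text \<open>
  The generator \<open>s\<^sub>i\<close> either prolongs or shortens the coset representative, when \<open>i\<close> is \<open>j - 1\<close> or \<open>j\<close>,
  or else it moves through the representative to the left and is absorbed by the normal form on one
  strand less.
\<close>

lemma normal_forms_mult_gen:
  "\<lbrakk>k \<le> n; w \<in> normal_forms k; 1 \<le> i; i < k\<rbrakk> \<Longrightarrow> w \<otimes> s i \<in> normal_forms k"
proof (induction k arbitrary: w i)
  case (Suc k)
  then obtain v j where v: "v \<in> normal_forms k" and j: "1 \<le> j" "j \<le> Suc k"
    and w: "w = v \<otimes> descend j (Suc k - j)"
    by auto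
  define d where "d = Suc k - j"
  have jd: "j + d = Suc k" using j by (simp add: d_def)
  have carr [simp]: "v \<in> carrier G" "descend j d \<in> carrier G" "s i \<in> carrier G"
    using normal_forms_closed[OF _ v] Suc.prems j jd by auto
  have mem: "v' \<otimes> descend j' (Suc k - j') \<in> normal_forms (Suc k)"
    if "v' \<in> normal_forms k" "1 \<le> j'" "j' \<le> Suc k" for v' j'
    using that by (auto intro!: image_eqI[of _ _ "(v', j')"])
  have ws: "w \<otimes> s i = v \<otimes> (descend j d \<otimes> s i)"
    by (simp add: w d_def[symmetric] m_assoc)
  consider "i + 1 = j" | "i = j" | "i + 2 \<le> j" | "j < i"
    by linarith
  then show ?case
  proof cases
    case 1
    then have "descend j d \<otimes> s i = descend i (Suc k - i)"
      using descend_append[of i d] Suc.prems jd by (auto simp: Suc_diff_le d_def)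
    then show ?thesis
      unfolding ws using mem[OF v, of i] Suc.prems by simp
  next
    case 2
    then obtain e where e: "d = Suc e"
      using jd Suc.prems by (cases d) auto
    moreover have "Suc k - Suc i = e"
      using e jd 2 by simp
    ultimately have "descend j d \<otimes> s i = descend (Suc i) (Suc k - Suc i)"
      using descend_cancel[of i e] Suc.prems(1,3) jd 2 by (simp del: descend.simps)
    then show ?thesis
      unfolding ws using mem[OF v, of "Suc i"] Suc.prems by simp
  next
    case 3
    then have "w \<otimes> s i = (v \<otimes> s i) \<otimes> descend j d"
      unfolding ws using descend_far[of j d i] Suc.prems jd j by (simp add: m_assoc)
    moreover have "v \<otimes> s i \<in> normal_forms k"
      using Suc.IH[OF _ v, of i] Suc.prems 3 j by simp
    ultimately show ?thesis
      using mem[of "v \<otimes> s i" j] j by (simp add: d_def)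
  next
    case 4
    have [simp]: "s (i - 1) \<in> carrier G"
      using 4 Suc.prems j by simp
    have "w \<otimes> s i = (v \<otimes> s (i - 1)) \<otimes> descend j d"
      unfolding ws using descend_shift[of j d i] Suc.prems jd j 4 by (simp add: m_assoc)
    moreover have "v \<otimes> s (i - 1) \<in> normal_forms k"
      using Suc.IH[OF _ v, of "i - 1"] Suc.prems 4 j by simp
    ultimately show ?thesis
      using mem[of "v \<otimes> s (i - 1)" j] j by (simp add: d_def)
  qed
qed simp

text \<open>
  The generators are their own inverses, so a set that contains \<open>\<one>\<close> and is closed under right
  multiplication by generators contains the whole generated subgroup.
\<close>

lemma generate_card_le_fact:
  "finite (generate G (s ` {1..<n}))" "card (generate G (s ` {1..<n})) \<le> fact n"
proof -
  have gens: "s ` {1..<n} \<subseteq> carrier G" by auto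
  have "w \<otimes> h \<in> normal_forms n"
    if "h \<in> generate G (s ` {1..<n})" "w \<in> normal_forms n" for w h
    using that
  proof (induction h arbitrary: w rule: generate.induct)
    case one
    then show ?case using normal_forms_closed[of n w] by simp
  next
    case (incl h)
    then show ?case using normal_forms_mult_gen by auto
  next
    case (inv h)
    then obtain i where i: "h = s i" "1 \<le> i" "i < n" by auto
    then have "inv h = s i"
      by (simp add: inv_equality involution)
    then show ?case using normal_forms_mult_gen inv i by auto
  next
    case (eng g h)
    then have "w \<in> carrier G" "g \<in> carrier G" "h \<in> carrier G"
      using normal_forms_closed generate_in_carrier[OF gens] by auto
    then show ?case using eng by (simp flip: m_assoc)
  qed
  from this[OF _ one_in_normal_forms] have sub: "generate G (s ` {1..<n}) \<subseteq> normal_forms n"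
    using generate_in_carrier[OF gens] by (metis l_one order_refl subsetI)
  then show "finite (generate G (s ` {1..<n}))"
    using card_normal_forms finite_subset by blast
  show "card (generate G (s ` {1..<n})) \<le> fact n"
    using card_mono[OF _ sub] card_normal_forms le_trans by blast
qed

end

section \<open>Recognising the symmetric group\<close>

lemma generate_adjacent_transpositions:
  "generate (sym_group n) ((\<lambda>i. transpose i (i + 1)) ` {1..<n}) = carrier (sym_group n)"
    (is "generate _ ?T = _")
proof -
  interpret S: group "sym_group n" by (rule sym_group_is_group)
  have T: "?T \<subseteq> carrier (sym_group n)"
    by (auto simp: sym_group_carrier intro!: permutes_swap_id)
  have mult: "p \<circ> q \<in> generate (sym_group n) ?T"
    if "p \<in> generate (sym_group n) ?T" "q \<in> generate (sym_group n) ?T" for p q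
    using generate.eng[OF that] by (simp add: sym_group_mult)
  have one: "id \<in> generate (sym_group n) ?T"
    using generate.one[of "sym_group n" ?T] by (simp add: sym_group_one)
  have adj: "apply_adj_transps xs \<in> generate (sym_group n) ?T" if "set xs \<subseteq> {1..<n}" for xs
    using that
  proof (induction xs)
    case (Cons x xs)
    then have "transpose x (x + 1) \<in> generate (sym_group n) ?T"
      by (intro generate.incl) auto
    moreover have "apply_adj_transps xs \<in> generate (sym_group n) ?T"
      using Cons by simp
    ultimately show ?case unfolding apply_adj_transps_Cons by (rule mult)
  qed (use one in simp)
  have lt: "transpose a b \<in> generate (sym_group n) ?T" if "a < b" "1 \<le> a" "b \<le> n" for a b
    using adj[of "adj_transp_seq a b"] adj_transp_seq_correct[of a b] set_adj_transp_seq[of a b] that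
    by auto
  have transp: "transpose a b \<in> generate (sym_group n) ?T"
    if "a \<noteq> b" "a \<in> {1..n}" "b \<in> {1..n}" for a b
    using lt[of a b] lt[of b a] that by (cases "a < b") (auto simp: transpose_commute)
  have "p \<in> generate (sym_group n) ?T" if "p permutes {1..n}" for p
    using that finite_atLeastAtMost[of 1 n]
  proof (induction p rule: permutes_induct)
    case id
    show ?case by (rule one)
  next
    case (swap a b p)
    then show ?case by (intro mult transp)
  qed
  then show ?thesis
    using S.generate_in_carrier[OF T] by (auto simp: sym_group_carrier)
qed

lemma coxeter_tuple_adjacent_transpositions:
  "coxeter_tuple (sym_group n) (\<lambda>i. transpose i (i + 1)) n"
proof -
  interpret S: group "sym_group n" by (rule sym_group_is_group)
  show ?thesis
  proof unfold_locales
    show "transpose i (i + 1) \<in> carrier (sym_group n)" if "1 \<le> i" "i < n" for i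
      using that by (auto simp: sym_group_carrier intro!: permutes_swap_id)
    show "S.commute (transpose i (i + 1)) (transpose j (j + 1))"
      if "1 \<le> i" "i + 2 \<le> j" "j < n" for i j
      using that by (auto simp: S.commute_def sym_group_mult fun_eq_iff transpose_def)
    show "S.braided (transpose i (i + 1)) (transpose (i + 1) (i + 1 + 1))"
      if "1 \<le> i" "i + 1 < n" for i
      using that by (auto simp: S.braided_def sym_group_mult fun_eq_iff transpose_def)
    show "transpose i (i + 1) \<otimes>\<^bsub>sym_group n\<^esub> transpose i (i + 1) = \<one>\<^bsub>sym_group n\<^esub>" for i
      by (simp add: sym_group_mult sym_group_one)
  qed
qed

lemma coxeter_tuple_DirProd:
  assumes "coxeter_tuple G s n" "coxeter_tuple H t n"
  shows "coxeter_tuple (G \<times>\<times> H) (\<lambda>i. (s i, t i)) n"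
proof -
  interpret G: coxeter_tuple G s n by fact
  interpret H: coxeter_tuple H t n by fact
  interpret P: group "G \<times>\<times> H" by (rule DirProd_group) unfold_locales
  show ?thesis
    using G.far_commute H.far_commute G.next_braided H.next_braided G.involution H.involution
    by unfold_locales
      (auto simp: P.commute_def G.commute_def H.commute_def
        P.braided_def G.braided_def H.braided_def)
qed

lemma subgroup_iso_if_surj_card_le:
  assumes hom: "h \<in> hom P G" and groups: "group P" "group G" and R: "subgroup R P"
    and surj: "h ` R = carrier G" and fin: "finite R" and le: "card R \<le> card (carrier G)"
  shows "P\<lparr>carrier := R\<rparr> \<cong> G"
proof -
  have "card (h ` R) = card R"
    using surj fin le card_image_le[of R h] by simp
  then have "inj_on h R"
    using fin by (rule eq_card_imp_inj_on[rotated])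
  moreover have "h \<in> hom (P\<lparr>carrier := R\<rparr>) G"
    using hom subgroup.subset[OF R] by (auto simp: hom_def)
  ultimately have "h \<in> iso (P\<lparr>carrier := R\<rparr>) G"
    using surj by (auto simp: iso_def bij_betw_def)
  then show ?thesis
    by (rule is_isoI)
qed

text \<open>
  The subgroup \<open>R\<close> below turns out to be the graph of the isomorphism. It is found without
  constructing a homomorphism from either side: the upper bound on its order and its two
  surjective projections are enough.
\<close>

lemma (in coxeter_tuple) iso_sym_group_if_large:
  assumes gen: "generate G (s ` {1..<n}) = carrier G" and ge: "fact n \<le> order G"
  shows "G \<cong> sym_group n"
proof -
  let ?S = "sym_group n" and ?t = "\<lambda>i::nat. transpose i (i + 1)"
  let ?P = "G \<times>\<times> ?S"
  interpret S: group ?S by (rule sym_group_is_group)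
  interpret P: coxeter_tuple ?P "\<lambda>i. (s i, ?t i)" n
    using coxeter_tuple_DirProd[OF coxeter_tuple_axioms coxeter_tuple_adjacent_transpositions] .
  let ?g = "(\<lambda>i. (s i, ?t i)) ` {1..<n}"
  define R where "R = generate ?P ?g"
  have g: "?g \<subseteq> carrier ?P" 
  proof (rule image_subsetI)
    fix i assume "i \<in> {1..<n}"
    then show "(s i, ?t i) \<in> carrier ?P"
      by (intro P.gen_closed) auto
  qed
  have R: "subgroup R ?P"
    unfolding R_def by (rule P.generate_is_subgroup[OF g])
  have finR: "finite R" and cardR: "card R \<le> fact n"
    unfolding R_def by (fact P.generate_card_le_fact)+
  have fst_hom: "fst \<in> hom ?P G" and snd_hom: "snd \<in> hom ?P ?S"
    by (auto simp: hom_def DirProd_def)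
  interpret F: group_hom ?P G fst by unfold_locales (rule fst_hom)
  interpret N: group_hom ?P ?S snd by unfold_locales (rule snd_hom)
  have "fst ` R = generate G (fst ` ?g)"
    unfolding R_def by (rule F.generate_img[OF g, symmetric])
  also have "fst ` ?g = s ` {1..<n}"
    by (simp add: image_image)
  finally have "fst ` R = carrier G"
    using gen by simp
  then have 1: "?P\<lparr>carrier := R\<rparr> \<cong> G"
    using cardR ge finR R fst_hom
    by (intro subgroup_iso_if_surj_card_le) (auto simp: order_def P.is_group is_group)
  have "snd ` R = generate ?S (snd ` ?g)"
    unfolding R_def by (rule N.generate_img[OF g, symmetric])
  also have "snd ` ?g = ?t ` {1..<n}"
    by (simp add: image_image)
  finally have "snd ` R = carrier ?S"
    using generate_adjacent_transpositions by simp
  then have 2: "?P\<lparr>carrier := R\<rparr> \<cong> ?S"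
    using cardR finR R snd_hom
    by (intro subgroup_iso_if_surj_card_le)
      (auto simp: sym_group_card_carrier P.is_group S.is_group)
  have "group (?P\<lparr>carrier := R\<rparr>)"
    using R by (rule P.subgroup_imp_group)
  with 1 have "G \<cong> ?P\<lparr>carrier := R\<rparr>"
    by (simp add: group.iso_sym)
  then show ?thesis
    using 2 by (rule iso_trans)
qed

section \<open>Non-cyclic quotients of the braid group\<close>

text \<open>
  A homomorphism with commutative image kills all commutators, hence the derived subgroup.
\<close>

lemma cyclic_hom_if_commutative_image:
  assumes B: "group B" and G: "group G" and f: "f \<in> hom B G"
    and comm: "\<And>x y. \<lbrakk>x \<in> carrier B; y \<in> carrier B\<rbrakk> \<Longrightarrow> f x \<otimes>\<^bsub>G\<^esub> f y = f y \<otimes>\<^bsub>G\<^esub> f x"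
  shows "cyclic_hom B G f"
proof -
  interpret group_hom B G f
    using B G f by (simp add: group_hom_def group_hom_axioms_def)
  let ?D = "derived B (carrier B)"
  have "f (x \<otimes>\<^bsub>B\<^esub> y \<otimes>\<^bsub>B\<^esub> inv\<^bsub>B\<^esub> x \<otimes>\<^bsub>B\<^esub> inv\<^bsub>B\<^esub> y) = \<one>\<^bsub>G\<^esub>" if "x \<in> carrier B" "y \<in> carrier B" for x y
    using that comm[OF that] by (simp add: H.m_assoc H.inv_mult_cancel)
  then have "derived_set B (carrier B) \<subseteq> kernel B G f"
    by (auto simp: kernel_def)
  then have D: "?D \<subseteq> kernel B G f"
    unfolding derived_def by (rule G.generate_subgroup_incl) (rule subgroup_kernel)
  have N: "?D \<lhd> B"
    by (rule G.derived_is_normal) (rule G.normal_self)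
  have "f x = f y" if xy: "x \<in> carrier B" "y \<in> carrier B" "?D #>\<^bsub>B\<^esub> x = ?D #>\<^bsub>B\<^esub> y" for x y
  proof -
    have "x \<in> ?D #>\<^bsub>B\<^esub> y"
      using G.rcos_self[OF xy(1) normal_imp_subgroup[OF N]] xy(3) by simp
    then obtain d where "d \<in> ?D" "x = d \<otimes>\<^bsub>B\<^esub> y"
      by (auto simp: r_coset_def)
    then show ?thesis
      using D xy by (auto simp: kernel_def)
  qed
  from FactGroup_universal[OF f N this] obtain g
    where "g \<in> hom (B Mod ?D) G" "\<And>x. x \<in> carrier B \<Longrightarrow> g (?D #>\<^bsub>B\<^esub> x) = f x"
    by blast
  then show ?thesis
    unfolding cyclic_hom_def by (intro bexI[of _ g]) simp_all
qed

text \<open>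
  The images of the generators inherit the braid relations from the presentation, and they
  generate \<open>G\<close> because every element of the presented group is the class of a word.
\<close>

lemma braid_quotient_tuple:
  assumes G: "group G" and f: "f \<in> epi (braid_group n) G"
  obtains s where "braid_tuple G s n" "generate G (s ` {1..<n}) = carrier G"
proof -
  interpret G: group G by (rule G)
  let ?S = "{1..<n}" and ?R = "braid_relations n"
  define cls where "cls w = word_cong ?S ?R `` {w}" for w
  define F where "F w = f (cls w)" for w
  have fhom: "f \<in> hom (braid_group n) G" and surj: "f ` carrier (braid_group n) = carrier G"
    using f by (auto simp: epi_def)
  interpret f: group_hom "braid_group n" G f
    by (simp add: group_hom_def group_hom_axioms_def group_braid_group G fhom)
  have carr: "carrier (braid_group n) = cls ` words ?S"
    by (auto simp: braid_group_def presented_group_def quotient_def cls_def)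
  have app: "F (u @ v) = F u \<otimes>\<^bsub>G\<^esub> F v" if "u \<in> words ?S" "v \<in> words ?S" for u v
  proof -
    have "cls (u @ v) = cls u \<otimes>\<^bsub>braid_group n\<^esub> cls v"
      using presented_group_mult[OF that, of ?R] by (simp add: cls_def braid_group_def)
    then show ?thesis
      using that carr by (simp add: F_def)
  qed
  have closed: "F w \<in> carrier G" if "w \<in> words ?S" for w
    using that carr surj by (auto simp: F_def)
  have nil: "F [] = \<one>\<^bsub>G\<^esub>"
    using f.hom_one by (simp add: F_def cls_def braid_group_def presented_group_def)
  have eqI: "F u = F v" if "(u, v) \<in> word_cong ?S ?R" for u v
    using equiv_class_eq[OF equiv_word_cong that] by (simp add: F_def cls_def)
  define s where "s i = F [\<sigma> i]" for i
  have s: "s i \<in> carrier G" if "i \<in> ?S" for i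
    using closed[of "[\<sigma> i]"] that by (simp add: s_def words_def)
  have two: "F [\<sigma> i, \<sigma> j] = s i \<otimes>\<^bsub>G\<^esub> s j" if "i \<in> ?S" "j \<in> ?S" for i j
    using app[of "[\<sigma> i]" "[\<sigma> j]"] that by (simp add: s_def words_def)
  have three: "F [\<sigma> i, \<sigma> j, \<sigma> k] = s i \<otimes>\<^bsub>G\<^esub> s j \<otimes>\<^bsub>G\<^esub> s k" if "i \<in> ?S" "j \<in> ?S" "k \<in> ?S" for i j k
    using app[of "[\<sigma> i, \<sigma> j]" "[\<sigma> k]"] two[of i j] that by (simp add: s_def words_def)
  have "braid_tuple G s n"
  proof unfold_locales
    show "s i \<in> carrier G" if "1 \<le> i" "i < n" for i
      using s that by simp
    show "G.commute (s i) (s j)" if "1 \<le> i" "i + 2 \<le> j" "j < n" for i j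
    proof -
      have "([\<sigma> i, \<sigma> j], [\<sigma> j, \<sigma> i]) \<in> word_cong ?S ?R"
        using that by (intro word_cong.relation) (auto simp: braid_relations_def words_def)
      from eqI[OF this] show ?thesis
        using two[of i j] two[of j i] that by (simp add: G.commute_def)
    qed
    show "G.braided (s i) (s (i + 1))" if "1 \<le> i" "i + 1 < n" for i
    proof -
      have "([\<sigma> i, \<sigma> (i + 1), \<sigma> i], [\<sigma> (i + 1), \<sigma> i, \<sigma> (i + 1)]) \<in> word_cong ?S ?R"
        using that by (intro word_cong.relation) (auto simp: braid_relations_def words_def)
      from eqI[OF this] show ?thesis
        using three[of i "i + 1" i] three[of "i + 1" i "i + 1"] that by (simp add: G.braided_def)
    qed
  qed
  moreover have "generate G (s ` ?S) = carrier G"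
  proof
    show "generate G (s ` ?S) \<subseteq> carrier G"
      using s by (intro G.generate_incl) auto
    have letter: "F [(i, b)] \<in> generate G (s ` ?S)" if i: "i \<in> ?S" for i b
    proof (cases b)
      case True
      then show ?thesis using i by (auto simp: s_def intro!: generate.incl)
    next
      case False
      have "([(i, False), \<sigma> i], []) \<in> word_cong ?S ?R"
        using word_cong.cancel[of i ?S False ?R] i by simp
      from eqI[OF this] have "F [(i, False)] \<otimes>\<^bsub>G\<^esub> s i = \<one>\<^bsub>G\<^esub>"
        using app[of "[(i, False)]" "[\<sigma> i]"] nil i by (simp add: s_def words_def)
      then have "F [(i, False)] = inv\<^bsub>G\<^esub> s i"
        using closed[of "[(i, False)]"] s[OF i] i by (simp add: words_def G.inv_equality)
      then show ?thesis using False i by (auto intro!: generate.inv)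
    qed
    have "F w \<in> generate G (s ` ?S)" if "w \<in> words ?S" for w
      using that
    proof (induction w)
      case Nil
      then show ?case by (simp add: nil generate.one)
    next
      case (Cons a w)
      obtain i b where a: "a = (i, b)" by fastforce
      have "i \<in> ?S" "w \<in> words ?S" "[a] \<in> words ?S"
        using Cons.prems a by (auto simp: words_def)
      then show ?case
        using app[of "[a]" w] letter[of i b] Cons.IH a generate.eng[of "F [a]" G _ "F w"] by simp
    qed
    then show "carrier G \<subseteq> generate G (s ` ?S)"
      unfolding surj[symmetric] carr by (auto simp: F_def)
  qed
  ultimately show ?thesis
    using that by blast
qed

text \<open>
  The centralizer is used twice: all of \<open>G\<close> centralizes the one remaining generator, and therefore
  this generator lies in the centre, which is then all of \<open>G\<close>.
\<close>

lemma (in braid_tuple) commutative_if_collapsed: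
  assumes gen: "generate G (s ` {1..<n}) = carrier G"
    and k: "1 \<le> k" "k + 1 < n" "commute (s k) (s (k + 1))"
    and xy: "x \<in> carrier G" "y \<in> carrier G"
  shows "x \<otimes> y = y \<otimes> x"
proof -
  have "s ` {1..<n} \<subseteq> {s 1}"
  proof (rule image_subsetI)
    fix i assume "i \<in> {1..<n}"
    then have "s i = s 1" by (intro gens_all_equal[OF k]) auto
    then show "s i \<in> {s 1}" by simp
  qed
  moreover have s1: "s 1 \<in> carrier G"
    using k by simp
  ultimately have "s ` {1..<n} \<subseteq> centralizer {s 1}"
    by (auto simp: centralizer_def)
  then have "carrier G \<subseteq> centralizer {s 1}"
    unfolding gen[symmetric] using s1 by (intro generate_subgroup_incl subgroup_centralizer) auto
  then have "{s 1} \<subseteq> centralizer (carrier G)"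
    using s1 commute_sym by (auto simp: centralizer_def)
  with \<open>s ` {1..<n} \<subseteq> {s 1}\<close> have "s ` {1..<n} \<subseteq> centralizer (carrier G)"
    by (rule subset_trans)
  then have "carrier G \<subseteq> centralizer (carrier G)"
    by (subst gen[symmetric]) (intro generate_subgroup_incl subgroup_centralizer, auto)
  then show ?thesis
    using xy by (auto simp: centralizer_def commute_def)
qed

lemma noncyclic_braid_quotient_tuple:
  assumes "noncyclic_braid_quotient n G"
  obtains s where "noncollapsed_braid_tuple G s n" "generate G (s ` {1..<n}) = carrier G"
proof -
  obtain f where G: "group G" and f: "f \<in> epi (braid_group n) G"
    and nc: "\<not> cyclic_hom (braid_group n) G f"
    using assms by (auto simp: noncyclic_braid_quotient_def)
  obtain s where "braid_tuple G s n" and gen: "generate G (s ` {1..<n}) = carrier G"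
    using braid_quotient_tuple[OF G f] by blast
  interpret braid_tuple G s n by fact
  have "noncollapsed_braid_tuple G s n"
  proof unfold_locales
    fix i assume i: "1 \<le> i" "i + 1 < n"
    show "\<not> commute (s i) (s (i + 1))"
    proof
      assume "commute (s i) (s (i + 1))"
      then have "cyclic_hom (braid_group n) G f"
        using f commutative_if_collapsed[OF gen i]
        by (intro cyclic_hom_if_commutative_image group_braid_group G) (auto simp: epi_def)
      with nc show False ..
    qed
  qed
  then show ?thesis
    using gen that by blast
qed

theorem theorem3:
  fixes n :: nat and G :: "('a, 'b) monoid_scheme"
  assumes "n \<in> {5, 6}"
    and "noncyclic_braid_quotient n G"
  shows "G \<cong> sym_group n \<or> infinite (carrier G) \<or> order G > fact n"
proof (rule ccontr)
  assume contra: "\<not> ?thesis"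
  obtain s where "noncollapsed_braid_tuple G s n" and gen: "generate G (s ` {1..<n}) = carrier G"
    using noncyclic_braid_quotient_tuple[OF assms(2)] by blast
  interpret noncollapsed_braid_tuple G s n by fact
  have fin: "finite (carrier G)" and le: "\<not> fact n < order G"
    using contra by auto
  then have inv: "s 1 \<otimes>\<^bsub>G\<^esub> s 1 = \<one>\<^bsub>G\<^esub>"
    using order_gt_fact_if_not_involution[OF assms(1)] by blast
  interpret coxeter_tuple G s n
    by unfold_locales (rule involutions[OF inv])
  have "G \<cong> sym_group n"
    using iso_sym_group_if_large[OF gen] order_ge_fact_if_involution[OF assms(1) fin inv] .
  with contra show False by blast
qed

end
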